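(* Let $\tilde{\mathbf f}:I\to\mathbf{R}_F$ be the fuzzy valued recurrent fractal interpolation function associated with the data $x_i,u_i,s_i,e_i,\alpha_i,\tilde{\mathbf q}_i$ described in the context. Then $\tilde{\mathbf f}$ is Hölder continuous, i.e. there are constants $H\ge0$ and $0<\tau\le1$ such that $d_\infty(\tilde{\mathbf f}(x),\tilde{\mathbf f}(y))\le H|x-y|^\tau$ for all $x,y\in I$.
   Context: $\mathbf{R}_F$ is the space of fuzzy numbers over $\mathbf{R}$ (normal, fuzzy convex, upper semicontinuous functions $u:\mathbf{R}\to[0,1]$ with compact support). For $u\in\mathbf{R}_F$ and $0\le\lambda\le1$ the $\lambda$-level set is the compact interval $[u]^\lambda=[u^-(\lambda),u^+(\lambda)]$ (for $\lambda=0$, the closure of the support). Addition $\oplus$ and multiplication by a real scalar $\alpha\ge0$ are levelwise: $(u\oplus v)^\pm(\lambda)=u^\pm(\lambda)+v^\pm(\lambda)$, $(\alpha u)^\pm(\lambda)=\alpha u^\pm(\lambda)$. The metric on $\mathbf{R}_F$ is $d_\infty(u,v)=\sup_{\lambda\in[0,1]}\max\{|u^-(\lambda)-v^-(\lambda)|,|u^+(\lambda)-v^+(\lambda)|\}$; $(\mathbf{R}_F,d_\infty)$ is complete. Data: $n\ge2$, real numbers $x_0<\cdots<x_n$, fuzzy numbers $u_0,\dots,u_n\in\mathbf{R}_F$, $I=[x_0,x_n]$, $I_i=[x_{i-1},x_i]$ ($i=1,\dots,n$). For each $i\in\{1,\dots,n\}$: integers $0\le s_i<e_i\le n$ with $e_i-s_i\ge2$;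 $\tilde I_{\sigma(i)}=[x_{s_i},x_{e_i}]$; the affine map $\tilde l_i:\tilde I_{\sigma(i)}\to I_i$, $\tilde l_i(x)=\frac{x_i-x_{i-1}}{x_{e_i}-x_{s_i}}(x-x_{s_i})+x_{i-1}$, with $\frac{x_i-x_{i-1}}{x_{e_i}-x_{s_i}}<1$; a vertical scaling factor $0\le\alpha_i<1$; a Lipschitz mapping $\tilde{\mathbf q}_i:I_i\to\mathbf{R}_F$ with $\alpha_iu_{s_i}\oplus\tilde{\mathbf q}_i(x_{i-1})=u_{i-1}$ and $\alpha_iu_{e_i}\oplus\tilde{\mathbf q}_i(x_i)=u_i$. The $n\times n$ matrix $M=(p_{st})$, $p_{st}=1/a_s$ if $I_s\subseteq\tilde I_{\sigma(t)}$ and $0$ otherwise, with $a_s$ the number of $i$ such that $I_s\subseteq\tilde I_{\sigma(i)}$, is assumed irreducible. The fuzzy valued recurrent fractal interpolation function (RFIF) $\tilde{\mathbf f}$ is the unique continuous function $I\to\mathbf{R}_F$ with $\tilde{\mathbf f}(x_i)=u_i$ for $i=0,\dots,n$ and $\tilde{\mathbf f}(x)=\alpha_i\tilde{\mathbf f}(\tilde l_i^{-1}(x))\oplus\tilde{\mathbf q}_i(x)$ for all $x\in I_i$, $i=1,\dots,n$ (its graph is the attractor of the recurrent iterated function system with maps $(x,u)\mapsto(\tilde l_i(x),\alpha_iu\oplus\tilde{\mathbf q}_i(\tilde l_i(x)))$ on $\tilde I_{\sigma(i)}\times\mathbf{R}_F$). *)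

theory Defs
  imports "HOL-Analysis.Analysis"
begin

section \<open>Fuzzy numbers\<close>

definition upper_semicontinuous :: "(real \<Rightarrow> real) \<Rightarrow> bool" where
  "upper_semicontinuous u \<longleftrightarrow> (\<forall>x c. u x < c \<longrightarrow> (\<forall>\<^sub>F y in nhds x. u y < c))"

definition fuzzy_convex :: "(real \<Rightarrow> real) \<Rightarrow> bool" where
  "fuzzy_convex u \<longleftrightarrow>
     (\<forall>x y. \<forall>t\<in>{0..1}. min (u x) (u y) \<le> u (t * x + (1 - t) * y))"

definition is_fuzzy_number :: "(real \<Rightarrow> real) \<Rightarrow> bool" where
  "is_fuzzy_number u \<longleftrightarrow>
     range u \<subseteq> {0..1} \<and> (\<exists>x. u x = 1) \<and> fuzzy_convex u \<and>
     upper_semicontinuous u \<and> compact (closure {x. 0 < u x})"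

typedef fuzzy = "{u. is_fuzzy_number u}"
  morphisms membership Abs_fuzzy
proof -
  have "\<forall>\<^sub>F y in nhds x. (if y = 0 then 1 else 0) < c"
    if "(if x = 0 then 1 else 0) < c" for x c :: real
  proof (cases "x = 0")
    case True
    then show ?thesis using that by auto
  next
    case False
    then have "\<forall>\<^sub>F y in nhds x. y \<in> - {0}"
      by (intro eventually_nhds_in_open) auto
    then show ?thesis by (rule eventually_mono) (use that False in auto)
  qed
  then have "is_fuzzy_number (\<lambda>x. if x = 0 then 1 else 0)"
    by (auto simp: is_fuzzy_number_def upper_semicontinuous_def fuzzy_convex_def)
  then show ?thesis by blast
qed

definition level :: "fuzzy \<Rightarrow> real \<Rightarrow> real set" where
  "level u l = (if l = 0 then closure {x. 0 < membership u x} else {x. l \<le> membership u x})"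

definition lo :: "fuzzy \<Rightarrow> real \<Rightarrow> real" where
  "lo u l = Inf (level u l)"

definition hi :: "fuzzy \<Rightarrow> real \<Rightarrow> real" where
  "hi u l = Sup (level u l)"

lemma is_fuzzy_membership: "is_fuzzy_number (membership u)"
  using membership by simp

lemma membership_nonneg: "0 \<le> membership u x"
  and membership_le_1: "membership u x \<le> 1"
proof -
  have "membership u x \<in> range (membership u)" by simp
  moreover have "range (membership u) \<subseteq> {0..1}"
    using is_fuzzy_membership[of u] by (simp only: is_fuzzy_number_def)
  ultimately have "membership u x \<in> {0..1}" by (rule rev_subsetD)
  then show "0 \<le> membership u x" "membership u x \<le> 1" by simp_all
qed

lemma level_antimono:
  assumes "0 \<le> l" "l \<le> m"
  shows "level u m \<subseteq> level u l"
proof (cases "l = 0 \<and> m \<noteq> 0")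
  case True
  then have "level u m \<subseteq> {x. 0 < membership u x}"
    using assms by (auto simp: level_def)
  then show ?thesis
    using True closure_subset[of "{x. 0 < membership u x}"] by (auto simp: level_def)
next
  case False
  then show ?thesis using assms by (auto simp: level_def)
qed

lemma level_eq_interval:
  assumes l: "l \<in> {0..1}"
  shows "level u l = {lo u l..hi u l}" "lo u l \<le> hi u l"
proof -
  have normal: "\<exists>x. membership u x = 1" and conv: "fuzzy_convex (membership u)"
    and usc: "upper_semicontinuous (membership u)"
    and supp: "compact (closure {x. 0 < membership u x})"
    using is_fuzzy_membership[of u] by (simp_all add: is_fuzzy_number_def)
  have cl: "closed (level u l)"
  proof (cases "l = 0")
    case False
    have "open {x. membership u x < l}"
    proof (subst open_subopen, rule ballI)
      fix x assume "x \<in> {x. membership u x < l}"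
      then have "membership u x < l" by simp
      then have "\<forall>\<^sub>F y in nhds x. membership u y < l"
        using usc unfolding upper_semicontinuous_def by blast
      then show "\<exists>T. open T \<and> x \<in> T \<and> T \<subseteq> {x. membership u x < l}"
        unfolding eventually_nhds by blast
    qed
    moreover have "level u l = - {x. membership u x < l}"
      using False by (auto simp: level_def)
    ultimately show ?thesis by (simp only: closed_Compl)
  qed (simp add: level_def)
  have "level u l \<subseteq> level u 0"
    using l by (intro level_antimono) auto
  moreover have "compact (level u 0)" using supp by (simp add: level_def)
  ultimately have co: "compact (level u l)"
    using cl compact_Int_closed[of "level u 0" "level u l"] by (simp add: Int_absorb1)
  obtain x where x: "membership u x = 1" using normal by blast
  then have "x \<in> level u 1" by (simp add: level_def)
  moreover have "level u 1 \<subseteq> level u l" using l by (intro level_antimono) auto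
  ultimately have ne: "x \<in> level u l" by blast
  have fc: "min (membership u x) (membership u y) \<le> membership u (t * x + s * y)"
    if "0 \<le> t" "0 \<le> s" "t + s = 1" for x y t s
  proof -
    have "s = 1 - t" "t \<in> {0..1}" using that by auto
    then show ?thesis using conv unfolding fuzzy_convex_def by blast
  qed
  have "convex {x. 0 < membership u x}"
  proof (rule convexI)
    fix x y t s :: real
    assume "x \<in> {x. 0 < membership u x}" "y \<in> {x. 0 < membership u x}"
      and ts: "0 \<le> t" "0 \<le> s" "t + s = 1"
    then have "0 < min (membership u x) (membership u y)" by simp
    also have "\<dots> \<le> membership u (t * x + s * y)" by (rule fc[OF ts])
    finally show "t *\<^sub>R x + s *\<^sub>R y \<in> {x. 0 < membership u x}" by simp
  qed
  moreover have "convex {x. l \<le> membership u x}"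
  proof (rule convexI)
    fix x y t s :: real
    assume "x \<in> {x. l \<le> membership u x}" "y \<in> {x. l \<le> membership u x}"
      and ts: "0 \<le> t" "0 \<le> s" "t + s = 1"
    then have "l \<le> min (membership u x) (membership u y)" by simp
    also have "\<dots> \<le> membership u (t * x + s * y)" by (rule fc[OF ts])
    finally show "t *\<^sub>R x + s *\<^sub>R y \<in> {x. l \<le> membership u x}" by simp
  qed
  ultimately have "convex (level u l)" by (simp add: level_def convex_closure)
  then have "connected (level u l)" by (rule convex_connected)
  then obtain a b where ab: "level u l = {a..b}"
    using co connected_compact_interval_1 by blast
  then have "a \<le> b" using ne by auto
  then have "lo u l = a" "hi u l = b" by (auto simp: lo_def hi_def ab)
  then show "level u l = {lo u l..hi u l}" "lo u l \<le> hi u l" using ab \<open>a \<le> b\<close> by auto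
qed

lemma
  assumes "0 \<le> l" "l \<le> m" "m \<le> 1"
  shows lo_mono: "lo u l \<le> lo u m" and hi_antimono: "hi u m \<le> hi u l"
proof -
  have l: "l \<in> {0..1}" and m: "m \<in> {0..1}" using assms by auto
  have "{lo u m..hi u m} \<subseteq> {lo u l..hi u l}"
    using level_antimono[OF assms(1,2), of u]
    unfolding level_eq_interval(1)[OF l] level_eq_interval(1)[OF m] .
  then show "lo u l \<le> lo u m" "hi u m \<le> hi u l"
    using level_eq_interval(2)[OF m, of u] by simp_all
qed

lemma mem_level_iff: "0 < l \<Longrightarrow> l \<le> 1 \<Longrightarrow> l \<le> membership u x \<longleftrightarrow> lo u l \<le> x \<and> x \<le> hi u l"
  using eqset_imp_iff[OF level_eq_interval(1)[of l u], of x] by (simp add: level_def)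

lemma fuzzy_eqI:
  assumes "\<And>l. l \<in> {0..1} \<Longrightarrow> lo u l = lo v l" "\<And>l. l \<in> {0..1} \<Longrightarrow> hi u l = hi v l"
  shows "u = v"
proof -
  have *: "l \<le> membership u x \<longleftrightarrow> l \<le> membership v x" if "0 < l" "l \<le> 1" for l x
    using assms[of l] that by (simp add: mem_level_iff)
  have "membership u x = membership v x" for x
    using *[of "membership u x" x] *[of "membership v x" x]
      membership_nonneg[of u x] membership_nonneg[of v x]
      membership_le_1[of u x] membership_le_1[of v x]
    by linarith
  then have "membership u = membership v" by (rule ext)
  then show ?thesis by (simp only: membership_inject)
qed

text \<open>
  By \<open>fuzzy_of_endpoints_exists\<close> below, a pair of functions \<open>L\<close>, \<open>R\<close> with \<open>L 1 \<le> R 1\<close> such that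
  \<open>L\<close> and \<open>- R\<close> satisfy the following property are the end points of the level sets of a fuzzy
  number.
\<close>
definition endpoint_fun :: "(real \<Rightarrow> real) \<Rightarrow> bool" where
  "endpoint_fun A \<longleftrightarrow>
     mono_on {0..1} A \<and>
     (\<forall>l\<in>{0<..1}. \<forall>z. (\<forall>m\<in>{0<..<l}. A m \<le> z) \<longrightarrow> A l \<le> z) \<and>
     (\<forall>z. (\<forall>m\<in>{0<..1}. z \<le> A m) \<longrightarrow> z \<le> A 0)"

lemma endpoint_fun_lo: "endpoint_fun (lo u)"
  and endpoint_fun_hi: "endpoint_fun (\<lambda>l. - hi u l)"
proof -
  have 1: "lo u l \<le> z \<and> z \<le> hi u l"
    if l: "0 < l" "l \<le> 1" and m: "\<forall>m\<in>{0<..<l}. lo u m \<le> z \<and> z \<le> hi u m" for l z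
  proof (rule ccontr)
    assume "\<not> ?thesis"
    then have "membership u z < l" using l mem_level_iff[of l u z] by auto
    then obtain m where "membership u z < m" "m < l" using dense by blast
    moreover have "0 < m" using calculation membership_nonneg[of u z] by linarith
    ultimately show False using m l mem_level_iff[of m u z] by auto
  qed
  have lohi: "lo u m \<le> hi u m" if "0 \<le> m" "m \<le> 1" for m
    using that level_eq_interval by auto
  have A: "lo u l \<le> z" if l: "l \<in> {0<..1}" and m: "\<forall>m\<in>{0<..<l}. lo u m \<le> z" for l z
  proof (cases "z \<le> hi u l")
    case True
    have "z \<le> hi u m" if "m \<in> {0<..<l}" for m
      using that l True hi_antimono[of m l u] by auto
    then show ?thesis using 1[of l z] l m by auto
  next
    case False then show ?thesis using lohi[of l] l by auto
  qed
  have B: "- hi u l \<le> z" if l: "l \<in> {0<..1}" and m: "\<forall>m\<in>{0<..<l}. - hi u m \<le> z" for l z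
  proof (cases "lo u l \<le> - z")
    case True
    have "lo u m \<le> - z" if "m \<in> {0<..<l}" for m
      using that l True lo_mono[of m l u] by auto
    then show ?thesis using 1[of l "- z"] l m by fastforce
  next
    case False then show ?thesis using lohi[of l] l by auto
  qed
  have in0: "lo u 0 \<in> level u 0" "hi u 0 \<in> level u 0"
    using level_eq_interval[of 0 u] by auto
  have C: "z \<le> lo u 0" if z: "\<forall>m\<in>{0<..1}. z \<le> lo u m" for z
  proof -
    have "z \<le> x" if "0 < membership u x" for x
      using z that mem_level_iff[of "membership u x" u x] membership_le_1[of u x] by force
    then have "{x. 0 < membership u x} \<subseteq> {z..}" by auto
    then have "level u 0 \<subseteq> {z..}"
      using closure_minimal[OF _ closed_atLeast] by (simp add: level_def)
    then show ?thesis using in0 by auto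
  qed
  have D: "z \<le> - hi u 0" if z: "\<forall>m\<in>{0<..1}. z \<le> - hi u m" for z
  proof -
    have "x \<le> - z" if "0 < membership u x" for x
      using z that mem_level_iff[of "membership u x" u x] membership_le_1[of u x] by force
    then have "{x. 0 < membership u x} \<subseteq> {..- z}" by auto
    then have "level u 0 \<subseteq> {..- z}"
      using closure_minimal[OF _ closed_atMost] by (simp add: level_def)
    then show ?thesis using in0 by auto
  qed
  show "endpoint_fun (lo u)" "endpoint_fun (\<lambda>l. - hi u l)"
    unfolding endpoint_fun_def using A B C D
    by (auto intro!: mono_onI lo_mono hi_antimono)
qed

lemma endpoint_fun_add:
  assumes A: "endpoint_fun A" and B: "endpoint_fun B"
  shows "endpoint_fun (\<lambda>l. A l + B l)"
proof -
  have mA: "A l \<le> A m" and mB: "B l \<le> B m" if "0 \<le> l" "l \<le> m" "m \<le> 1" for l m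
    using A B that by (auto simp: endpoint_fun_def mono_on_def)
  have left: "A l + B l \<le> z"
    if l: "l \<in> {0<..1}" and z: "\<forall>m\<in>{0<..<l}. A m + B m \<le> z" for l z
  proof (rule ccontr)
    assume n: "\<not> ?thesis"
    define e where "e = (A l + B l - z) / 2"
    have e: "e > 0" using n by (simp add: e_def)
    obtain a where a: "a \<in> {0<..<l}" "A a > A l - e"
      using A l e unfolding endpoint_fun_def by (meson diff_less_eq less_add_same_cancel1 not_le)
    obtain b where b: "b \<in> {0<..<l}" "B b > B l - e"
      using B l e unfolding endpoint_fun_def by (meson diff_less_eq less_add_same_cancel1 not_le)
    have "max a b \<in> {0<..<l}" using a b by auto
    then have "A (max a b) + B (max a b) \<le> z" using z by blast
    moreover have "A a \<le> A (max a b)" "B b \<le> B (max a b)"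
      using a b l by (intro mA mB; auto)+
    ultimately show False using a b by (simp add: e_def field_simps)
  qed
  have zero: "z \<le> A 0 + B 0" if z: "\<forall>m\<in>{0<..1}. z \<le> A m + B m" for z
  proof (rule ccontr)
    assume n: "\<not> ?thesis"
    define e where "e = (z - (A 0 + B 0)) / 2"
    have e: "e > 0" using n by (simp add: e_def)
    obtain a where a: "a \<in> {0<..1}" "A a < A 0 + e"
      using A e unfolding endpoint_fun_def by (meson less_add_same_cancel1 not_le)
    obtain b where b: "b \<in> {0<..1}" "B b < B 0 + e"
      using B e unfolding endpoint_fun_def by (meson less_add_same_cancel1 not_le)
    have "min a b \<in> {0<..1}" using a b by auto
    then have "z \<le> A (min a b) + B (min a b)" using z by blast
    moreover have "A (min a b) \<le> A a" "B (min a b) \<le> B b"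
      using a b by (intro mA mB; auto)+
    ultimately show False using a b by (simp add: e_def field_simps)
  qed
  show ?thesis
    unfolding endpoint_fun_def using left zero
    by (auto intro!: mono_onI add_mono mA mB)
qed

lemma endpoint_fun_scale:
  assumes A: "endpoint_fun A" and c: "0 \<le> c"
  shows "endpoint_fun (\<lambda>l. c * A l)"
proof (cases "c = 0")
  case True
  have "\<exists>m. 0 < m \<and> m < l" if "0 < l" for l :: real using that dense by blast
  moreover have "\<exists>m::real. 0 < m \<and> m \<le> 1" by (rule exI[of _ 1]) simp
  ultimately show ?thesis using True
    by (fastforce simp: endpoint_fun_def mono_on_def)
next
  case False
  then have c: "c > 0" using c by simp
  have *: "c * a \<le> z \<longleftrightarrow> a \<le> z / c" "z \<le> c * a \<longleftrightarrow> z / c \<le> a" for a z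
    using c by (auto simp: field_simps)
  have "mono_on {0..1} (\<lambda>l. c * A l)"
    using A c by (auto simp: endpoint_fun_def mono_on_def)
  moreover have "c * A l \<le> z"
    if "l \<in> {0<..1}" "\<forall>m\<in>{0<..<l}. c * A m \<le> z" for l z
    using A that unfolding endpoint_fun_def * by blast
  moreover have "z \<le> c * A 0" if "\<forall>m\<in>{0<..1}. z \<le> c * A m" for z
    using A that unfolding endpoint_fun_def * by blast
  ultimately show ?thesis unfolding endpoint_fun_def by blast
qed

lemma fuzzy_of_endpoints_exists:
  assumes L: "endpoint_fun L" and R: "endpoint_fun (\<lambda>l. - R l)" and 1: "L 1 \<le> R 1"
  shows "\<exists>!w. \<forall>l\<in>{0..1}. lo w l = L l \<and> hi w l = R l"
proof -
  have mL: "L l \<le> L m" and mR: "R m \<le> R l" if "0 \<le> l" "l \<le> m" "m \<le> 1" for l m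
    using L R that by (auto simp: endpoint_fun_def mono_on_def)
  have LR: "L l \<le> R l" if "0 \<le> l" "l \<le> 1" for l
    using mL[of l 1] mR[of l 1] 1 that by linarith
  define S where "S z = insert 0 {l \<in> {0..1}. L l \<le> z \<and> z \<le> R l}" for z
  define W where "W z = Sup (S z)" for z
  have S: "S z \<noteq> {}" "bdd_above (S z)" "S z \<subseteq> {0..1}" "0 \<in> S z" for z
    by (auto simp: S_def intro!: bdd_aboveI[of _ 1])
  have W0: "0 \<le> W z" for z unfolding W_def using S by (intro cSup_upper) auto
  have W1: "W z \<le> 1" for z unfolding W_def using S by (intro cSup_least) force+
  have key: "l \<le> W z \<longleftrightarrow> L l \<le> z \<and> z \<le> R l" if l: "0 < l" "l \<le> 1" for l z
  proof
    assume lW: "l \<le> W z"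
    have *: "L m \<le> z \<and> - R m \<le> - z" if m: "m \<in> {0<..<l}" for m
    proof -
      have "m < Sup (S z)" using lW m by (auto simp: W_def)
      then obtain k where k: "k \<in> S z" "m < k"
        using S less_cSup_iff by blast
      then have "0 \<le> m" "m \<le> k" "k \<le> 1" "L k \<le> z" "z \<le> R k"
        using m by (auto simp: S_def)
      then show ?thesis using mL[of m k] mR[of m k] by auto
    qed
    have "L l \<le> z" using L l * unfolding endpoint_fun_def by auto
    moreover have "- R l \<le> - z" using R l * unfolding endpoint_fun_def
      by (metis greaterThanAtMost_iff)
    ultimately show "L l \<le> z \<and> z \<le> R l" by simp
  next
    assume "L l \<le> z \<and> z \<le> R l"
    then show "l \<le> W z" unfolding W_def using S l by (intro cSup_upper) (auto simp: S_def)
  qed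
  have sub: "{x. 0 < W x} \<subseteq> {L 0..R 0}"
  proof
    fix x assume "x \<in> {x. 0 < W x}"
    then have "L (W x) \<le> x \<and> x \<le> R (W x)" using key[of "W x" x] W1[of x] by auto
    then show "x \<in> {L 0..R 0}" using mL[of 0 "W x"] mR[of 0 "W x"] W0[of x] W1[of x] by auto
  qed
  have "is_fuzzy_number W"
    unfolding is_fuzzy_number_def
  proof (intro conjI)
    show "range W \<subseteq> {0..1}" using W0 W1 by auto
    have "1 \<le> W (L 1)" using key[of 1 "L 1"] 1 by auto
    then show "\<exists>x. W x = 1" using W1 by (intro exI[of _ "L 1"] antisym) auto
    show "fuzzy_convex W"
      unfolding fuzzy_convex_def
    proof (intro allI ballI)
      fix x y t :: real assume t: "t \<in> {0..1}"
      let ?k = "min (W x) (W y)"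
      show "?k \<le> W (t * x + (1 - t) * y)"
      proof (cases "?k \<le> 0")
        case True then show ?thesis using W0 order_trans by blast
      next
        case False
        then have k: "0 < ?k" "?k \<le> 1" using W1[of x] by auto
        have "x \<in> {L ?k..R ?k}" "y \<in> {L ?k..R ?k}"
          using key[OF k, of x] key[OF k, of y] by auto
        then have "t *\<^sub>R x + (1 - t) *\<^sub>R y \<in> {L ?k..R ?k}"
          using t by (intro convexD[OF convex_real_interval(5)]) auto
        then show ?thesis using key[OF k] by auto
      qed
    qed
    show "upper_semicontinuous W"
      unfolding upper_semicontinuous_def
    proof (intro allI impI)
      fix x c assume c: "W x < c"
      show "\<forall>\<^sub>F y in nhds x. W y < c"
      proof (cases "c \<le> 1")
        case False
        then have "W y < c" for y using W1[of y] by linarith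
        then show ?thesis by simp
      next
        case True
        have c0: "0 < c" using c W0[of x] by linarith
        have eq: "y \<in> - {L c..R c} \<longleftrightarrow> W y < c" for y
          using key[OF c0 True, of y] by auto
        have "\<forall>\<^sub>F y in nhds x. y \<in> - {L c..R c}"
          using c eq by (intro eventually_nhds_in_open) (auto simp: open_Compl)
        then show ?thesis unfolding eq .
      qed
    qed
    have "bounded {x. 0 < W x}" using sub bounded_closed_interval bounded_subset by blast
    then show "compact (closure {x. 0 < W x})" by simp
  qed
  then have mW: "membership (Abs_fuzzy W) = W" by (simp add: Abs_fuzzy_inverse)
  let ?w = "Abs_fuzzy W"
  have pos: "lo ?w l = L l \<and> hi ?w l = R l" if l: "0 < l" "l \<le> 1" for l
  proof -
    have "level ?w l = {L l..R l}" using l key by (auto simp: level_def mW)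
    then show ?thesis using LR[of l] l by (simp add: lo_def hi_def)
  qed
  have "level ?w 0 \<subseteq> {L 0..R 0}"
    unfolding level_def mW using sub by (simp add: closure_minimal)
  then have "L 0 \<le> lo ?w 0" "hi ?w 0 \<le> R 0"
    using level_eq_interval[of 0 ?w] by auto
  moreover have "lo ?w 0 \<le> L 0"
    using L pos lo_mono[of 0 _ ?w] unfolding endpoint_fun_def
    by (metis greaterThanAtMost_iff less_imp_le order_refl)
  moreover have "- hi ?w 0 \<le> - R 0"
    using R pos hi_antimono[of 0 _ ?w] unfolding endpoint_fun_def
    by (metis greaterThanAtMost_iff less_imp_le neg_le_iff_le order_refl)
  ultimately have "\<forall>l\<in>{0..1}. lo ?w l = L l \<and> hi ?w l = R l"
    using pos by (metis atLeastAtMost_iff antisym neg_le_iff_le order_le_less)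
  then show ?thesis by (intro ex1I[of _ ?w]) (auto intro!: fuzzy_eqI)
qed

definition fuzzy_add :: "fuzzy \<Rightarrow> fuzzy \<Rightarrow> fuzzy" (infixl \<open>\<oplus>\<close> 65) where
  "u \<oplus> v = (THE w. \<forall>l\<in>{0..1}. lo w l = lo u l + lo v l \<and> hi w l = hi u l + hi v l)"

text \<open>Only meaningful for a nonnegative scalar.\<close>
definition fuzzy_scale :: "real \<Rightarrow> fuzzy \<Rightarrow> fuzzy" (infixr \<open>\<odot>\<close> 70) where
  "c \<odot> u = (THE w. \<forall>l\<in>{0..1}. lo w l = c * lo u l \<and> hi w l = c * hi u l)"

lemma fuzzy_add_levels:
  assumes "l \<in> {0..1}"
  shows "lo (u \<oplus> v) l = lo u l + lo v l" "hi (u \<oplus> v) l = hi u l + hi v l"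
proof -
  have "endpoint_fun (\<lambda>l. - (hi u l + hi v l))"
    using endpoint_fun_add[OF endpoint_fun_hi[of u] endpoint_fun_hi[of v]] by simp
  moreover have "lo u 1 + lo v 1 \<le> hi u 1 + hi v 1"
    by (intro add_mono level_eq_interval) auto
  ultimately have "\<exists>!w. \<forall>l\<in>{0..1}. lo w l = lo u l + lo v l \<and> hi w l = hi u l + hi v l"
    by (intro fuzzy_of_endpoints_exists endpoint_fun_add endpoint_fun_lo)
  from theI'[OF this] show "lo (u \<oplus> v) l = lo u l + lo v l" "hi (u \<oplus> v) l = hi u l + hi v l"
    using assms by (auto simp: fuzzy_add_def)
qed

lemma fuzzy_scale_levels:
  assumes "l \<in> {0..1}" "0 \<le> c"
  shows "lo (c \<odot> u) l = c * lo u l" "hi (c \<odot> u) l = c * hi u l"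
proof -
  have "endpoint_fun (\<lambda>l. - (c * hi u l))"
    using endpoint_fun_scale[OF endpoint_fun_hi[of u] assms(2)] by simp
  moreover have "c * lo u 1 \<le> c * hi u 1"
    using assms by (intro mult_left_mono level_eq_interval) auto
  ultimately have "\<exists>!w. \<forall>l\<in>{0..1}. lo w l = c * lo u l \<and> hi w l = c * hi u l"
    using assms by (intro fuzzy_of_endpoints_exists endpoint_fun_scale endpoint_fun_lo)
  from theI'[OF this] show "lo (c \<odot> u) l = c * lo u l" "hi (c \<odot> u) l = c * hi u l"
    using assms by (auto simp: fuzzy_scale_def)
qed

text \<open>The metric \<open>d\<^sub>\<infinity>\<close>.\<close>

instantiation fuzzy :: metric_space
begin

definition dist_fuzzy :: "fuzzy \<Rightarrow> fuzzy \<Rightarrow> real" where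
  "dist_fuzzy u v = (SUP l\<in>{0..1}. max \<bar>lo u l - lo v l\<bar> \<bar>hi u l - hi v l\<bar>)"

definition uniformity_fuzzy :: "(fuzzy \<times> fuzzy) filter" where
  "uniformity_fuzzy = (INF e\<in>{0<..}. principal {(u, v). dist u v < e})"

definition open_fuzzy :: "fuzzy set \<Rightarrow> bool" where
  "open_fuzzy U = (\<forall>u\<in>U. \<forall>\<^sub>F (u', v) in uniformity. u' = u \<longrightarrow> v \<in> U)"

lemma bdd_above_dist_fuzzy:
  "bdd_above ((\<lambda>l. max \<bar>lo u l - lo v l\<bar> \<bar>hi u l - hi v l\<bar>) ` {0..1})"
proof (rule bdd_aboveI2)
  fix l :: real assume l: "l \<in> {0..1}"
  have *: "lo w 0 \<le> lo w l \<and> lo w l \<le> hi w l \<and> hi w l \<le> hi w 0" for w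
    using l lo_mono[of 0 l w] hi_antimono[of 0 l w] level_eq_interval(2)[of l w] by auto
  show "max \<bar>lo u l - lo v l\<bar> \<bar>hi u l - hi v l\<bar> \<le> \<bar>hi u 0 - lo v 0\<bar> + \<bar>hi v 0 - lo u 0\<bar>"
    using *[of u] *[of v] by linarith
qed

instance
proof
  fix u v w :: fuzzy
  have upper: "max \<bar>lo u l - lo v l\<bar> \<bar>hi u l - hi v l\<bar> \<le> dist u v" if "l \<in> {0..1}" for u v l
    unfolding dist_fuzzy_def using bdd_above_dist_fuzzy that by (rule cSUP_upper2[where x = l]) auto
  show "(dist u v = 0) = (u = v)"
  proof
    assume 0: "dist u v = 0"
    show "u = v" using upper[of _ u v] 0 by (intro fuzzy_eqI) fastforce+
  qed (simp add: dist_fuzzy_def)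
  show "dist u v \<le> dist u w + dist v w"
  proof (subst dist_fuzzy_def, rule cSUP_least)
    fix l :: real assume "l \<in> {0..1}"
    then show "max \<bar>lo u l - lo v l\<bar> \<bar>hi u l - hi v l\<bar> \<le> dist u w + dist v w"
      using upper[of l u w] upper[of l v w] by linarith
  qed simp
qed (simp_all add: uniformity_fuzzy_def open_fuzzy_def)

end

section \<open>Recurrent fractal interpolation\<close>

definition rfif_domain_map :: "(nat \<Rightarrow> real) \<Rightarrow> (nat \<Rightarrow> nat) \<Rightarrow> (nat \<Rightarrow> nat) \<Rightarrow> nat \<Rightarrow> real \<Rightarrow> real" where
  "rfif_domain_map x s e i t =
     (x i - x (i - 1)) / (x (e i) - x (s i)) * (t - x (s i)) + x (i - 1)"

definition connection_matrix ::
    "nat \<Rightarrow> (nat \<Rightarrow> real) \<Rightarrow> (nat \<Rightarrow> nat) \<Rightarrow> (nat \<Rightarrow> nat) \<Rightarrow> nat \<Rightarrow> nat \<Rightarrow> real" where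
  "connection_matrix n x s e j k =
     (if {x (j - 1)..x j} \<subseteq> {x (s k)..x (e k)}
      then 1 / real (card {i \<in> {1..n}. {x (j - 1)..x j} \<subseteq> {x (s i)..x (e i)}})
      else 0)"

text \<open>
  Irreducibility of a nonnegative matrix with indices \<open>1, \<dots>, n\<close>: any two indices \<open>i\<close>, \<open>j\<close> are
  joined by a chain \<open>i = i\<^sub>0, i\<^sub>1, \<dots>, i\<^sub>k = j\<close> with \<open>k \<ge> 1\<close> and all entries
  \<open>P i\<^sub>r i\<^sub>r\<^sub>+\<^sub>1\<close> positive.
\<close>
definition irreducible_matrix :: "nat \<Rightarrow> (nat \<Rightarrow> nat \<Rightarrow> real) \<Rightarrow> bool" where
  "irreducible_matrix n P \<longleftrightarrow>
     (\<forall>i\<in>{1..n}. \<forall>j\<in>{1..n}. (i, j) \<in> {(a, b). a \<in> {1..n} \<and> b \<in> {1..n} \<and> 0 < P a b}\<^sup>+)"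

text \<open>
  Since \<open>0 \<le> \<alpha>\<^sub>i < 1\<close> will be assumed, at most one function on \<open>[x\<^sub>0, x\<^sub>n]\<close> satisfies these
  conditions.  The values of \<open>f\<close> outside this interval are irrelevant.
\<close>
definition is_fuzzy_RFIF ::
    "nat \<Rightarrow> (nat \<Rightarrow> real) \<Rightarrow> (nat \<Rightarrow> fuzzy) \<Rightarrow> (nat \<Rightarrow> nat) \<Rightarrow> (nat \<Rightarrow> nat) \<Rightarrow> (nat \<Rightarrow> real) \<Rightarrow>
     (nat \<Rightarrow> real \<Rightarrow> fuzzy) \<Rightarrow> (real \<Rightarrow> fuzzy) \<Rightarrow> bool" where
  "is_fuzzy_RFIF n x u s e \<alpha> q f \<longleftrightarrow>
     continuous_on {x 0..x n} f \<and>
     (\<forall>i\<in>{0..n}. f (x i) = u i) \<and>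
     (\<forall>i\<in>{1..n}. \<forall>t\<in>{x (i - 1)..x i}.
        f t = \<alpha> i \<odot> f (inv_into {x (s i)..x (e i)} (rfif_domain_map x s e i) t) \<oplus> q i t)"

end

theory Submission
  imports Defs
begin

text \<open>
  The function is governed by one inequality. If \<open>y\<close>, \<open>z\<close> lie in the same
  interval \<open>I\<^sub>i\<close>, and \<open>y'\<close>, \<open>z'\<close> are their preimages under the affine map with ratio \<open>c\<^sub>i\<close>, the
  functional equation gives
  \<open>d(f y, f z) \<le> \<alpha>\<^sub>i d(f y', f z') + L \<bar>y - z\<bar>\<close> with \<open>\<bar>y - z\<bar> = c\<^sub>i \<bar>y' - z'\<bar>\<close>.
  Since \<open>\<alpha>\<^sub>i < 1\<close>, an exponent \<open>\<tau>\<close> close to \<open>0\<close> satisfies \<open>\<alpha>\<^sub>i \<le> \<beta> c\<^sub>i\<^sup>\<tau>\<close> for all \<open>i\<close> with one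
  \<open>\<beta> < 1\<close>. A bound \<open>H \<bar>y' - z'\<bar>\<^sup>\<tau>\<close> then yields the bound \<open>(\<beta> H + const) \<bar>y - z\<bar>\<^sup>\<tau>\<close>, which is at
  most \<open>H \<bar>y - z\<bar>\<^sup>\<tau>\<close> once \<open>H\<close> is large. Passing to preimages expands distances by a definite
  factor, so after finitely many steps the pair can no longer be handled this way, and it remains
  to bound such terminal pairs directly (\<open>holder_bound_by_expansion\<close>).

  In general a terminal pair consists of points that are separated by a node but may be arbitrarily close.
  Splitting such a pair at the node inside the recursion would cost a factor that \<open>\<beta>\<close> need not
  absorb. The argument is therefore run twice. In the first run one of the two points is a node;
  preimages of the ends of \<open>I\<^sub>i\<close> are the ends of the domain interval, hence
  nodes again, and the terminal pairs are those at a distance bounded below, which the boundedness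
  of \<open>f\<close> takes care of. In the second run the pairs are arbitrary, and a terminal pair is split at
  a node only once, by means of the first run.
\<close>

section \<open>The metric on fuzzy numbers\<close>

lemma level_dist_le_dist:
  assumes "l \<in> {0..1}"
  shows "\<bar>lo u l - lo v l\<bar> \<le> dist u v" "\<bar>hi u l - hi v l\<bar> \<le> dist u v"
proof -
  have "max \<bar>lo u l - lo v l\<bar> \<bar>hi u l - hi v l\<bar> \<le> dist u v"
    unfolding dist_fuzzy_def using bdd_above_dist_fuzzy assms
    by (rule cSUP_upper2[where x = l]) auto
  then show "\<bar>lo u l - lo v l\<bar> \<le> dist u v" "\<bar>hi u l - hi v l\<bar> \<le> dist u v" by auto
qed

lemma fuzzy_dist_leI:
  assumes "\<And>l. l \<in> {0..1} \<Longrightarrow> \<bar>lo u l - lo v l\<bar> \<le> b"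
    and "\<And>l. l \<in> {0..1} \<Longrightarrow> \<bar>hi u l - hi v l\<bar> \<le> b"
  shows "dist u v \<le> b"
  unfolding dist_fuzzy_def by (rule cSUP_least) (use assms in auto)

lemma dist_fuzzy_scale_add_le:
  assumes a: "0 \<le> a"
  shows "dist (a \<odot> u \<oplus> p) (a \<odot> v \<oplus> q) \<le> a * dist u v + dist p q"
proof -
  have *: "\<bar>a * r + r' - (a * t + t')\<bar> \<le> a * dist u v + dist p q"
    if "\<bar>r - t\<bar> \<le> dist u v" "\<bar>r' - t'\<bar> \<le> dist p q" for r r' t t'
  proof -
    have "\<bar>a * r + r' - (a * t + t')\<bar> = \<bar>a * (r - t) + (r' - t')\<bar>" by (simp add: algebra_simps)
    also have "\<dots> \<le> a * \<bar>r - t\<bar> + \<bar>r' - t'\<bar>"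
      using a by (simp add: abs_mult order_trans[OF abs_triangle_ineq])
    also have "\<dots> \<le> a * dist u v + dist p q" using that a by (intro add_mono mult_left_mono)
    finally show ?thesis .
  qed
  show ?thesis
    by (rule fuzzy_dist_leI)
      (simp_all add: fuzzy_add_levels fuzzy_scale_levels a * level_dist_le_dist)
qed

section \<open>Hoelder bounds along an expanding recursion\<close>

text \<open>
  The expansion factor is bounded below by \<open>1 / \<gamma> > 1\<close> and the distances of admissible pairs
  are bounded above by \<open>D\<close>, so the recursion starting in a pair of distinct points ends; the
  induction is on its length. The constant \<open>A / (1 - \<beta>)\<close> is the fixed point of
  \<open>H \<mapsto> \<beta> H + A\<close>.
\<close>
lemma holder_bound_by_expansion:
  fixes f :: "'a::metric_space \<Rightarrow> 'b::metric_space" and P :: "'a \<Rightarrow> 'a \<Rightarrow> bool"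
  assumes \<beta>: "\<beta> < 1" and \<gamma>: "0 < \<gamma>" "\<gamma> < 1"
    and D: "\<And>y z. P y z \<Longrightarrow> dist y z \<le> D"
    and step: "\<And>y z. P y z \<Longrightarrow> y \<noteq> z \<Longrightarrow>
      dist (f y) (f z) \<le> B * dist y z powr \<tau> \<or>
      (\<exists>y' z' a c. P y' z' \<and> 0 < c \<and> c \<le> \<gamma> \<and> 0 \<le> a \<and> a \<le> \<beta> * c powr \<tau> \<and>
         dist y z = c * dist y' z' \<and>
         dist (f y) (f z) \<le> a * dist (f y') (f z') + A * dist y z powr \<tau>)"
  shows "\<exists>H\<ge>0. \<forall>y z. P y z \<longrightarrow> dist (f y) (f z) \<le> H * dist y z powr \<tau>"
proof -
  define H where "H = max 0 (max B (A / (1 - \<beta>)))"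
  have H: "0 \<le> H" "B \<le> H" "A / (1 - \<beta>) \<le> H" by (auto simp: H_def)
  then have A: "\<beta> * H + A \<le> H" using \<beta> by (simp add: field_simps)
  have main: "dist (f y) (f z) \<le> H * dist y z powr \<tau>"
    if "P y z" "D * \<gamma> ^ k < dist y z" "y \<noteq> z" for k y z
    using that
  proof (induction k arbitrary: y z)
    case 0
    then show ?case using D[of y z] by simp
  next
    case (Suc k)
    from step[OF Suc.prems(1,3)] show ?case
    proof
      assume "dist (f y) (f z) \<le> B * dist y z powr \<tau>"
      also have "\<dots> \<le> H * dist y z powr \<tau>" using H by (intro mult_right_mono) auto
      finally show ?thesis .
    next
      assume "\<exists>y' z' a c. P y' z' \<and> 0 < c \<and> c \<le> \<gamma> \<and> 0 \<le> a \<and> a \<le> \<beta> * c powr \<tau> \<and>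
         dist y z = c * dist y' z' \<and>
         dist (f y) (f z) \<le> a * dist (f y') (f z') + A * dist y z powr \<tau>"
      then obtain y' z' a c where P: "P y' z'" and c: "0 < c" "c \<le> \<gamma>"
        and a: "0 \<le> a" "a \<le> \<beta> * c powr \<tau>" and d: "dist y z = c * dist y' z'"
        and le: "dist (f y) (f z) \<le> a * dist (f y') (f z') + A * dist y z powr \<tau>"
        by blast
      have "\<gamma> * (D * \<gamma> ^ k) < c * dist y' z'" using Suc.prems(2) d by (simp add: mult_ac)
      also have "\<dots> \<le> \<gamma> * dist y' z'" using c by (intro mult_right_mono) auto
      finally have "D * \<gamma> ^ k < dist y' z'" using \<gamma> by simp
      moreover have "y' \<noteq> z'" using d Suc.prems(3) by auto
      ultimately have IH: "dist (f y') (f z') \<le> H * dist y' z' powr \<tau>"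
        using Suc.IH P by blast
      have "a * dist (f y') (f z') \<le> (\<beta> * c powr \<tau>) * (H * dist y' z' powr \<tau>)"
        using a IH by (intro mult_mono) auto
      also have "\<dots> = \<beta> * H * dist y z powr \<tau>" using c by (simp add: d powr_mult)
      finally have "dist (f y) (f z) \<le> (\<beta> * H + A) * dist y z powr \<tau>"
        using le by (simp add: algebra_simps)
      also have "\<dots> \<le> H * dist y z powr \<tau>" using A by (intro mult_right_mono) auto
      finally show ?thesis .
    qed
  qed
  have "dist (f y) (f z) \<le> H * dist y z powr \<tau>" if P: "P y z" for y z
  proof (cases "y = z")
    case False
    then have pos: "0 < dist y z" by simp
    have "(\<lambda>k. D * \<gamma> ^ k) \<longlonglongrightarrow> D * 0"
      using \<gamma> by (intro tendsto_mult_left LIMSEQ_realpow_zero) auto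
    then have "\<forall>\<^sub>F k in sequentially. D * \<gamma> ^ k < dist y z"
      using pos by (intro order_tendstoD(2)[where y = 0]) auto
    then obtain k where "D * \<gamma> ^ k < dist y z" using eventually_happens' by force
    then show ?thesis using main P False by blast
  qed simp
  then show ?thesis using H(1) by blast
qed

text \<open>
  As \<open>\<tau>\<close> decreases to \<open>0\<close>, each quotient \<open>\<alpha>\<^sub>i / c\<^sub>i\<^sup>\<tau>\<close> tends to \<open>\<alpha>\<^sub>i < 1\<close>.
\<close>
lemma common_holder_exponent_exists:
  fixes \<alpha> c :: "'i \<Rightarrow> real"
  assumes I: "finite I" and \<alpha>: "\<And>i. i \<in> I \<Longrightarrow> \<alpha> i < 1" and c: "\<And>i. i \<in> I \<Longrightarrow> 0 < c i"
  shows "\<exists>\<tau> \<beta>. 0 < \<tau> \<and> \<tau> \<le> 1 \<and> \<beta> < 1 \<and> (\<forall>i\<in>I. \<alpha> i \<le> \<beta> * c i powr \<tau>)"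
proof -
  have "\<forall>\<^sub>F \<tau> in at_right 0. \<alpha> i / c i powr \<tau> < 1" if i: "i \<in> I" for i
  proof (rule order_tendstoD(2))
    have "((\<lambda>\<tau>. \<alpha> i / c i powr \<tau>) \<longlongrightarrow> \<alpha> i / c i powr 0) (at_right 0)"
      using c[OF i] by (intro tendsto_intros) auto
    then show "((\<lambda>\<tau>. \<alpha> i / c i powr \<tau>) \<longlongrightarrow> \<alpha> i) (at_right 0)" using c[OF i] by simp
  qed (rule \<alpha>[OF i])
  then have "\<forall>\<^sub>F \<tau> in at_right 0. \<forall>i\<in>I. \<alpha> i / c i powr \<tau> < 1"
    using I by (simp add: eventually_ball_finite_distrib)
  moreover have "\<forall>\<^sub>F \<tau>::real in at_right 0. \<tau> \<in> {0<..<1}"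
    by (rule eventually_at_right_real) simp
  ultimately have "\<forall>\<^sub>F \<tau> in at_right 0. \<tau> \<in> {0<..<1} \<and> (\<forall>i\<in>I. \<alpha> i / c i powr \<tau> < 1)"
    by (simp add: eventually_conj_iff)
  from eventually_happens'[OF trivial_limit_at_right_real this]
  obtain \<tau> where \<tau>: "0 < \<tau>" "\<tau> < 1" and lt: "\<forall>i\<in>I. \<alpha> i / c i powr \<tau> < 1"
    by auto
  define \<beta> where "\<beta> = Max (insert 0 ((\<lambda>i. \<alpha> i / c i powr \<tau>) ` I))"
  have "\<beta> < 1" unfolding \<beta>_def using I lt by (subst Max_less_iff) auto
  moreover have "\<alpha> i \<le> \<beta> * c i powr \<tau>" if i: "i \<in> I" for i
  proof -
    have "\<alpha> i / c i powr \<tau> \<le> \<beta>" unfolding \<beta>_def using I i by (intro Max_ge) auto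
    then show ?thesis using c[OF i] by (simp add: pos_divide_le_eq)
  qed
  ultimately show ?thesis using \<tau> by (meson less_imp_le)
qed

text \<open>
  On a bounded set a Lipschitz bound is a Hoelder bound for every exponent at most \<open>1\<close>.
\<close>
lemma le_powr_times_powr_diff:
  fixes d D \<tau> :: real
  assumes "0 < d" "d \<le> D" "\<tau> \<le> 1"
  shows "d \<le> D powr (1 - \<tau>) * d powr \<tau>"
proof -
  have "d = d powr (1 - \<tau>) * d powr \<tau>" using assms by (simp flip: powr_add)
  also have "\<dots> \<le> D powr (1 - \<tau>) * d powr \<tau>"
    using assms by (intro mult_right_mono powr_mono2) auto
  finally show ?thesis .
qed

section \<open>Nodes and preimages\<close>

lemma nodes_mono:
  fixes x :: "nat \<Rightarrow> 'a::linorder"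
  assumes x: "\<And>i. i < n \<Longrightarrow> x i < x (Suc i)" and "i \<le> j" "j \<le> n"
  shows "x i \<le> x j"
  using assms(2,3)
proof (induction j rule: dec_induct)
  case (step m)
  then show ?case using x[of m] by (auto intro: order.trans less_imp_le)
qed simp

lemma node_interval_cover:
  fixes x :: "nat \<Rightarrow> 'a::linorder"
  assumes "0 < n" "t \<in> {x 0..x n}"
  shows "\<exists>i\<in>{1..n}. t \<in> {x (i - 1)..x i}"
  using assms
proof (induction n)
  case (Suc n)
  show ?case
  proof (cases "n = 0 \<or> x n \<le> t")
    case True
    then show ?thesis using Suc.prems by (intro bexI[of _ "Suc n"]) auto
  next
    case False
    then have "0 < n" "t \<in> {x 0..x n}" using Suc.prems by auto
    from Suc.IH[OF this] obtain i where "i \<in> {1..n}" "t \<in> {x (i - 1)..x i}" by blast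
    then show ?thesis by (intro bexI[of _ i]) auto
  qed
qed simp

lemma inv_into_rfif_domain_map:
  assumes i: "x (i - 1) < x i" and se: "x (s i) < x (e i)" and t: "t \<in> {x (i - 1)..x i}"
  defines "c \<equiv> (x i - x (i - 1)) / (x (e i) - x (s i))"
  defines "g \<equiv> x (s i) + (t - x (i - 1)) / c"
  shows "inv_into {x (s i)..x (e i)} (rfif_domain_map x s e i) t = g"
    and "g \<in> {x (s i)..x (e i)}"
proof -
  have c: "0 < c" and c': "x i - x (i - 1) = c * (x (e i) - x (s i))"
    using i se by (auto simp: c_def)
  have map: "rfif_domain_map x s e i r = c * (r - x (s i)) + x (i - 1)" for r
    by (simp add: rfif_domain_map_def c_def)
  have "(t - x (i - 1)) / c \<le> x (e i) - x (s i)"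
    using c c' t by (auto simp: pos_divide_le_eq mult.commute)
  moreover have "0 \<le> (t - x (i - 1)) / c" using c t by auto
  ultimately show g: "g \<in> {x (s i)..x (e i)}" by (auto simp: g_def)
  have "inj_on (rfif_domain_map x s e i) {x (s i)..x (e i)}"
    using c by (auto simp: inj_on_def map)
  moreover have "rfif_domain_map x s e i g = t" using c by (simp add: map g_def)
  ultimately show "inv_into {x (s i)..x (e i)} (rfif_domain_map x s e i) t = g"
    using g by (intro inv_into_f_eq)
qed

section \<open>Hoelder continuity\<close>

theorem theorem3:
  fixes n :: nat and x :: "nat \<Rightarrow> real" and u :: "nat \<Rightarrow> fuzzy"
    and s e :: "nat \<Rightarrow> nat" and \<alpha> :: "nat \<Rightarrow> real"
    and q :: "nat \<Rightarrow> real \<Rightarrow> fuzzy" and f :: "real \<Rightarrow> fuzzy"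
  assumes "2 \<le> n"
    and "\<And>i. i < n \<Longrightarrow> x i < x (Suc i)"
    and "\<And>i. i \<in> {1..n} \<Longrightarrow> s i < e i \<and> e i \<le> n \<and> 2 \<le> e i - s i"
    and "\<And>i. i \<in> {1..n} \<Longrightarrow> (x i - x (i - 1)) / (x (e i) - x (s i)) < 1"
    and "\<And>i. i \<in> {1..n} \<Longrightarrow> 0 \<le> \<alpha> i \<and> \<alpha> i < 1"
    and "\<And>i. i \<in> {1..n} \<Longrightarrow> \<exists>C. C-lipschitz_on {x (i - 1)..x i} (q i)"
    and "\<And>i. i \<in> {1..n} \<Longrightarrow> \<alpha> i \<odot> u (s i) \<oplus> q i (x (i - 1)) = u (i - 1)"
    and "\<And>i. i \<in> {1..n} \<Longrightarrow> \<alpha> i \<odot> u (e i) \<oplus> q i (x i) = u i"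
    and "irreducible_matrix n (connection_matrix n x s e)"
    and "is_fuzzy_RFIF n x u s e \<alpha> q f"
  shows "\<exists>H \<tau>. 0 \<le> H \<and> 0 < \<tau> \<and> \<tau> \<le> 1 \<and>
           (\<forall>y\<in>{x 0..x n}. \<forall>z\<in>{x 0..x n}. dist (f y) (f z) \<le> H * \<bar>y - z\<bar> powr \<tau>)"
proof -
  let ?I = "{x 0..x n}"
  note mono = nodes_mono[of n x, OF assms(2)]
  have gap: "x (i - 1) < x i" if "i \<in> {1..n}" for i
    using assms(2)[of "i - 1"] that by auto
  have dom: "x (s i) < x (e i)" if i: "i \<in> {1..n}" for i
    using assms(2)[of "s i"] mono[of "Suc (s i)" "e i"] assms(3)[OF i] by fastforce
  have domI: "{x (s i)..x (e i)} \<subseteq> ?I" if i: "i \<in> {1..n}" for i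
    using mono[of 0 "s i"] mono[of "e i" n] assms(3)[OF i] by auto
  have node: "x j \<in> ?I" if "j \<le> n" for j using mono[of 0 j] mono[of j n] that by auto
  define c where "c i = (x i - x (i - 1)) / (x (e i) - x (s i))" for i
  define g where "g i t = x (s i) + (t - x (i - 1)) / c i" for i t
  have c0: "0 < c i" and c1: "c i < 1" if "i \<in> {1..n}" for i
    using gap[OF that] dom[OF that] assms(4)[OF that] by (auto simp: c_def)
  have g_mem: "g i t \<in> ?I" if "i \<in> {1..n}" "t \<in> {x (i - 1)..x i}" for i t
    using inv_into_rfif_domain_map(2)[where x = x and s = s and e = e,
        OF gap[OF that(1)] dom[OF that(1)] that(2)]
      domI[OF that(1)] unfolding g_def c_def by blast
  have g_left: "g i (x (i - 1)) = x (s i)" for i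
    by (simp add: g_def)
  have g_right: "g i (x i) = x (e i)" if "i \<in> {1..n}" for i
    using gap[OF that] dom[OF that] by (simp add: g_def c_def)
  have g_dist: "dist y z = c i * dist (g i y) (g i z)" if "i \<in> {1..n}" for i y z
  proof -
    have "g i y - g i z = (y - z) / c i" by (simp add: g_def diff_divide_distrib)
    then show ?thesis using c0[OF that] by (simp add: dist_real_def)
  qed
  have f_eq: "f t = \<alpha> i \<odot> f (g i t) \<oplus> q i t" if "i \<in> {1..n}" "t \<in> {x (i - 1)..x i}" for i t
    using assms(10) that
      inv_into_rfif_domain_map(1)[where x = x and s = s and e = e,
        OF gap[OF that(1)] dom[OF that(1)] that(2)]
    unfolding is_fuzzy_RFIF_def g_def c_def by simp
  have cont: "continuous_on ?I f" using assms(10) by (simp add: is_fuzzy_RFIF_def)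

  obtain \<tau> \<beta> where \<tau>: "0 < \<tau>" "\<tau> \<le> 1" and \<beta>: "\<beta> < 1"
    and \<alpha>\<beta>: "\<And>i. i \<in> {1..n} \<Longrightarrow> \<alpha> i \<le> \<beta> * c i powr \<tau>"
    using common_holder_exponent_exists[of "{1..n}" \<alpha> c] assms(5) c0 by auto
  define \<gamma> where "\<gamma> = Max (c ` {1..n})"
  have \<gamma>: "c i \<le> \<gamma>" if "i \<in> {1..n}" for i unfolding \<gamma>_def using that by (intro Max_ge) auto
  have \<gamma>1: "\<gamma> < 1" unfolding \<gamma>_def using c1 assms(1) by (subst Max_less_iff) auto
  have \<gamma>0: "0 < \<gamma>" using c0[of 1] \<gamma>[of 1] assms(1) by auto
  define \<delta> where "\<delta> = Min ((\<lambda>i. x i - x (i - 1)) ` {1..n})"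
  have \<delta>: "\<delta> \<le> x i - x (i - 1)" if "i \<in> {1..n}" for i
    unfolding \<delta>_def using that by (intro Min_le) auto
  have \<delta>0: "0 < \<delta>" unfolding \<delta>_def using gap assms(1) by (subst Min_gr_iff) auto

  obtain L' where L': "\<And>i. i \<in> {1..n} \<Longrightarrow> (L' i)-lipschitz_on {x (i - 1)..x i} (q i)"
    using assms(6) by metis
  define L where "L = Max (L' ` {1..n})"
  have L: "dist (q i y) (q i z) \<le> L * dist y z"
    if "i \<in> {1..n}" "y \<in> {x (i - 1)..x i}" "z \<in> {x (i - 1)..x i}" for i y z
  proof -
    have "dist (q i y) (q i z) \<le> L' i * dist y z"
      using lipschitz_onD[OF L'] that by blast
    also have "L' i \<le> L" unfolding L_def using that by (intro Max_ge) auto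
    finally show ?thesis by (simp add: mult_right_mono)
  qed
  have "L' 1 \<le> L" unfolding L_def using assms(1) by (intro Max_ge) auto
  then have L0: "0 \<le> L" using lipschitz_on_nonneg[OF L'[of 1]] assms(1) by simp
  define D where "D = x n - x 0"
  have D: "dist y z \<le> D" if "y \<in> ?I" "z \<in> ?I" for y z
    using that by (auto simp: D_def dist_real_def)
  define A where "A = L * D powr (1 - \<tau>)"

  have recursion: "\<alpha> i \<le> \<beta> * c i powr \<tau> \<and> 0 \<le> \<alpha> i \<and> 0 < c i \<and> c i \<le> \<gamma> \<and>
      dist y z = c i * dist (g i y) (g i z) \<and>
      dist (f y) (f z) \<le> \<alpha> i * dist (f (g i y)) (f (g i z)) + A * dist y z powr \<tau>"
    if i: "i \<in> {1..n}" and yz: "y \<in> {x (i - 1)..x i}" "z \<in> {x (i - 1)..x i}" "y \<noteq> z" for i y z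
  proof (intro conjI)
    have "i - 1 \<le> n" "i \<le> n" using i by auto
    then have I: "y \<in> ?I" "z \<in> ?I" using node[of i] node[of "i - 1"] yz by auto
    have "dist (f y) (f z) \<le> \<alpha> i * dist (f (g i y)) (f (g i z)) + dist (q i y) (q i z)"
      unfolding f_eq[OF i yz(1)] f_eq[OF i yz(2)]
      using assms(5)[OF i] by (intro dist_fuzzy_scale_add_le) auto
    also have "dist (q i y) (q i z) \<le> L * dist y z" using L i yz by blast
    also have "\<dots> \<le> L * (D powr (1 - \<tau>) * dist y z powr \<tau>)"
      using L0 D[OF I] \<tau> yz(3) by (intro mult_left_mono le_powr_times_powr_diff) auto
    finally show "dist (f y) (f z) \<le> \<alpha> i * dist (f (g i y)) (f (g i z)) + A * dist y z powr \<tau>"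
      by (simp add: A_def mult.assoc)
  qed (use \<alpha>\<beta>[OF i] assms(5)[OF i] c0[OF i] \<gamma>[OF i] g_dist[OF i] in blast)+

  have bounded: "bounded (f ` ?I)"
    by (intro compact_imp_bounded compact_continuous_image cont compact_Icc)
  have diam: "dist (f y) (f z) \<le> diameter (f ` ?I)" if "y \<in> ?I" "z \<in> ?I" for y z
    by (intro diameter_bounded_bound bounded imageI that)

  have "\<exists>H\<ge>0. \<forall>y z. y \<in> x ` {0..n} \<and> z \<in> ?I \<longrightarrow> dist (f y) (f z) \<le> H * dist y z powr \<tau>"
  proof (rule holder_bound_by_expansion[OF \<beta> \<gamma>0 \<gamma>1,
        where D = D and A = A and B = "diameter (f ` ?I) / \<delta> powr \<tau>"])
    fix y z assume P: "y \<in> x ` {0..n} \<and> z \<in> ?I"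
    then obtain j where j: "y = x j" "j \<le> n" by auto
    have yI: "y \<in> ?I" using node j by auto
    show "dist y z \<le> D" using D yI P by blast
    assume ne: "y \<noteq> z"
    show "dist (f y) (f z) \<le> diameter (f ` ?I) / \<delta> powr \<tau> * dist y z powr \<tau> \<or>
      (\<exists>y' z' a b. (y' \<in> x ` {0..n} \<and> z' \<in> ?I) \<and> 0 < b \<and> b \<le> \<gamma> \<and> 0 \<le> a \<and>
         a \<le> \<beta> * b powr \<tau> \<and> dist y z = b * dist y' z' \<and>
         dist (f y) (f z) \<le> a * dist (f y') (f z') + A * dist y z powr \<tau>)"
    proof (cases "\<delta> \<le> dist y z")
      case True
      then have "\<delta> powr \<tau> \<le> dist y z powr \<tau>" using \<delta>0 \<tau> by (intro powr_mono2) auto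
      then have "diameter (f ` ?I) * 1 \<le> diameter (f ` ?I) * (dist y z powr \<tau> / \<delta> powr \<tau>)"
        using \<delta>0 diameter_ge_0[OF bounded] by (intro mult_left_mono) auto
      then show ?thesis using diam[OF yI, of z] P by auto
    next
      case False
      \<comment> \<open>The node \<open>y\<close> is closer to \<open>z\<close> than to its neighbours, so it is an end of the interval
        containing \<open>z\<close>.\<close>
      have "\<exists>i\<in>{1..n}. y \<in> {x (i - 1)..x i} \<and> z \<in> {x (i - 1)..x i} \<and> g i y \<in> x ` {0..n}"
      proof (cases "x j < z")
        case True
        then have "j \<noteq> n" using P by auto
        then have i: "Suc j \<in> {1..n}" using j by auto
        then have "z \<le> x (Suc j)" using \<delta>[OF i] False True j by (auto simp: dist_real_def)
        moreover have "g (Suc j) y \<in> x ` {0..n}"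
          using g_left[of "Suc j"] assms(3)[OF i] j by auto
        ultimately show ?thesis using gap[OF i] True i j by (intro bexI[of _ "Suc j"]) auto
      next
        case z: False
        then have "j \<noteq> 0" using P ne j by (cases "j = 0") auto
        then have i: "j \<in> {1..n}" using j by auto
        then have "x (j - 1) \<le> z" using \<delta>[OF i] False z j by (auto simp: dist_real_def)
        moreover have "g j y \<in> x ` {0..n}" using g_right[OF i] assms(3)[OF i] j by auto
        ultimately show ?thesis using gap[OF i] z i j by (intro bexI[of _ j]) auto
      qed
      then obtain i where i: "i \<in> {1..n}" "y \<in> {x (i - 1)..x i}" "z \<in> {x (i - 1)..x i}"
        and "g i y \<in> x ` {0..n}" by blast
      then show ?thesis using recursion[OF i ne] g_mem[OF i(1,3)]
        by (intro disjI2 exI[of _ "g i y"] exI[of _ "g i z"] exI[of _ "\<alpha> i"] exI[of _ "c i"]) blast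
    qed
  qed
  then obtain K where K0: "0 \<le> K"
    and K: "\<And>j z. j \<le> n \<Longrightarrow> z \<in> ?I \<Longrightarrow> dist (f (x j)) (f z) \<le> K * dist (x j) z powr \<tau>"
    by fastforce

  have separated: "dist (f y) (f z) \<le> 2 * K * dist y z powr \<tau>"
    if "j \<le> n" "y \<in> ?I" "z \<in> ?I" "y \<le> x j" "x j \<le> z" for j y z
  proof -
    have "dist (f y) (f z) \<le> dist (f (x j)) (f y) + dist (f (x j)) (f z)"
      by (rule dist_triangle3)
    also have "\<dots> \<le> K * dist (x j) y powr \<tau> + K * dist (x j) z powr \<tau>"
      using K that by (intro add_mono) auto
    also have "\<dots> \<le> K * dist y z powr \<tau> + K * dist y z powr \<tau>"
      using that K0 \<tau> by (intro add_mono mult_left_mono powr_mono2) (auto simp: dist_real_def)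
    finally show ?thesis by simp
  qed
  have "\<exists>H\<ge>0. \<forall>y z. y \<in> ?I \<and> z \<in> ?I \<longrightarrow> dist (f y) (f z) \<le> H * dist y z powr \<tau>"
  proof (rule holder_bound_by_expansion[OF \<beta> \<gamma>0 \<gamma>1, where D = D and A = A and B = "2 * K"])
    fix y z assume P: "y \<in> ?I \<and> z \<in> ?I"
    show "dist y z \<le> D" using D P by blast
    assume ne: "y \<noteq> z"
    obtain i where i: "i \<in> {1..n}" "y \<in> {x (i - 1)..x i}"
      using node_interval_cover[of n y x] assms(1) P by auto
    obtain j where j: "j \<in> {1..n}" "z \<in> {x (j - 1)..x j}"
      using node_interval_cover[of n z x] assms(1) P by auto
    consider "i = j" | "i < j" | "j < i" by linarith
    then show "dist (f y) (f z) \<le> 2 * K * dist y z powr \<tau> \<or>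
      (\<exists>y' z' a b. (y' \<in> ?I \<and> z' \<in> ?I) \<and> 0 < b \<and> b \<le> \<gamma> \<and> 0 \<le> a \<and>
         a \<le> \<beta> * b powr \<tau> \<and> dist y z = b * dist y' z' \<and>
         dist (f y) (f z) \<le> a * dist (f y') (f z') + A * dist y z powr \<tau>)"
    proof cases
      case 1
      then have z: "z \<in> {x (i - 1)..x i}" using j by simp
      show ?thesis using recursion[OF i z ne] g_mem[OF i] g_mem[OF i(1) z]
        by (intro disjI2 exI[of _ "g i y"] exI[of _ "g i z"] exI[of _ "\<alpha> i"] exI[of _ "c i"]) blast
    next
      case 2
      then have "x i \<le> x (j - 1)" using mono[of i "j - 1"] j by auto
      then show ?thesis using separated[of i y z] i j P by auto
    next
      case 3
      then have "x j \<le> x (i - 1)" using mono[of j "i - 1"] i by auto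
      then show ?thesis using separated[of j z y] i j P by (auto simp: dist_commute)
    qed
  qed
  then show ?thesis using \<tau> by (force simp: dist_real_def)
qed

end
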